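(* Let $\mathcal{P}_n$ be the Pell numbers, i.e., $\mathcal{P}_0=0$, $\mathcal{P}_1=1$, and $\mathcal{P}_{n+2}=2\mathcal{P}_{n+1}+\mathcal{P}_n$ for $n\ge 0$. Then for all integers $n\geq 1$ and $m\geq 2$, $$\sum_{(k_1,k_2,k_3)\in K(3,n-1)} \mathcal{P}_{k_1} F_{k_2}^{(m-1)} F_{k_3}^{(m)} = \sum_{j=0}^n F_j^{(m-1)} \left( \mathcal{P}_{n-j} - F_{n-j}^{(m)}\right) - \sum_{j=0}^{n-1} \mathcal{P}_j F_{n-1-j}^{(m)}.$$
   Context: For each integer $m\ge 1$ the Fibonacci $m$-step numbers $F_n^{(m)}$ are defined by $F_n^{(m)}=0$ for $n=-(m-2),\ldots,0$ (with $F_0^{(1)}=0$ when $m=1$), $F_1^{(m)}=1$, and $F_n^{(m)}=\sum_{j=1}^m F_{n-j}^{(m)}$ for all $n\ge 2$. In particular $F_n^{(1)}=1$ for all $n\ge 1$. Notation: $K(\ell,b)=\{(k_1,\ldots,k_\ell)\in\mathbb{Z}_{\ge 0}^\ell : k_1+\cdots+k_\ell=b\}$. *)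

theory Defs
  imports Main
begin

text \<open>
  Fibonacci \<open>m\<close>-step numbers (\<open>m \<ge> 1\<close>), indexed by integers so that the recurrence can
  refer to the initial zeros at \<open>n = -(m-2), \<dots>, 0\<close>. Values at smaller indices, set to \<open>0\<close>
  here, and the case \<open>m = 0\<close> are never used.
\<close>

function fib_step :: "nat \<Rightarrow> int \<Rightarrow> int" where
  "fib_step m n =
    (if n \<le> 0 then 0 else if n = 1 then 1 else (\<Sum>j = 1..m. fib_step m (n - int j)))"
  by auto
termination by (relation "measure (\<lambda>(m, n). nat n)") auto

text \<open>The defining equation loops when used as an unconditional simplification rule.\<close>

declare fib_step.simps [simp del]

fun pell :: "nat \<Rightarrow> int" where
  "pell 0 = 0"
| "pell (Suc 0) = 1"
| "pell (Suc (Suc n)) = 2 * pell (Suc n) + pell n"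

text \<open>An \<open>l\<close>-tuple of natural numbers is represented by a list of length \<open>l\<close>.\<close>

definition K :: "nat \<Rightarrow> nat \<Rightarrow> nat list set" where
  "K l b = {ks. length ks = l \<and> sum_list ks = b}"

end

theory Submission
  imports Defs "HOL-Computational_Algebra.Formal_Power_Series"
begin

text \<open>
  Both sides of the identity are coefficients of power series. Let \<open>P\<close>, \<open>A\<close>, \<open>B\<close> be the
  generating functions of the Pell numbers, the \<open>(m - 1)\<close>-step numbers and the \<open>m\<close>-step numbers,
  and put \<open>s = X + X\<^sup>2 + \<dots> + X\<^bsup>m-1\<^esup>\<close>. The three recurrences say
  \<open>P (1 - 2X - X\<^sup>2) = X\<close>, \<open>A (1 - s) = X\<close> and \<open>B (1 - X - X s) = X\<close>,
  where the last denominator uses \<open>X + \<dots> + X\<^sup>m = X + X s\<close>. The theorem is the equality of the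
  coefficients of \<open>X\<^sup>n\<close> in \<open>X P A B = A (P - B) - X P B\<close>. This holds because the denominators
  satisfy
  \<open>(1 - X - X s) - (1 - 2X - X\<^sup>2) = X (1 - s) + X\<^sup>2\<close>:
  multiplying by \<open>P A B\<close> turns the left-hand side into \<open>X (A P - A B)\<close> and the right-hand side
  into \<open>X\<^sup>2 P B + X\<^sup>2 P A B\<close>, and one factor \<open>X\<close> can be cancelled.
\<close>

unbundle fps_syntax

definition pell_fps :: "int fps" where
  "pell_fps = Abs_fps pell"

definition fib_step_fps :: "nat \<Rightarrow> int fps" where
  "fib_step_fps m = Abs_fps (\<lambda>n. fib_step m (int n))"

lemma pell_fps_nth [simp]: "pell_fps $ n = pell n"
  by (simp add: pell_fps_def)

lemma fib_step_fps_nth [simp]: "fib_step_fps m $ n = fib_step m (int n)"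
  by (simp add: fib_step_fps_def)

lemma pell_fps_eq: "pell_fps * (1 - 2 * fps_X - fps_X ^ 2) = fps_X"
proof (rule fps_ext)
  fix n
  have expand: "pell_fps * (1 - 2 * fps_X - fps_X ^ 2)
      = pell_fps - 2 * (pell_fps * fps_X) - pell_fps * fps_X ^ 2"
    by (simp add: algebra_simps)
  show "(pell_fps * (1 - 2 * fps_X - fps_X ^ 2)) $ n = fps_X $ n"
    unfolding expand
    by (cases n rule: pell.cases)
       (simp_all add: fps_X_power_mult_right_nth fps_numeral_fps_const)
qed

lemma fib_step_nonpos: "n \<le> 0 \<Longrightarrow> fib_step m n = 0"
  by (subst fib_step.simps) simp

text \<open>
  The coefficient of \<open>X\<^sup>n\<close> on the left is the defect of the \<open>m\<close>-step recurrence at \<open>n\<close>, which is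
  nonzero only at \<open>n = 1\<close>, where the value is prescribed instead of being a sum of zeros.
\<close>

lemma fib_step_fps_eq: "fib_step_fps m * (1 - (\<Sum>j = 1..m. fps_X ^ j)) = fps_X"
proof (rule fps_ext)
  fix n
  \<comment> \<open>Where \<open>j > n\<close>, the power series has no term and the recurrence a vanishing one.\<close>
  have shift: "(fib_step_fps m * fps_X ^ j) $ n = fib_step m (int n - int j)" for j
    by (simp add: fps_X_power_mult_right_nth of_nat_diff fib_step_nonpos)
  have "(fib_step_fps m * (1 - (\<Sum>j = 1..m. fps_X ^ j))) $ n
      = fib_step m (int n) - (\<Sum>j = 1..m. fib_step m (int n - int j))"
    by (simp add: right_diff_distrib sum_distrib_left fps_sum_nth shift)
  also have "\<dots> = fps_X $ n"
  proof (cases "n \<le> 1")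
    case True
    then have "(\<Sum>j = 1..m. fib_step m (int n - int j)) = 0"
      by (intro sum.neutral ballI fib_step_nonpos) auto
    moreover have "fib_step m (int n) = (if n = 1 then 1 else 0)"
      using True by (subst fib_step.simps) auto
    ultimately show ?thesis
      by (simp add: fps_X_nth)
  next
    case False
    then show ?thesis
      by (subst fib_step.simps) (simp add: fps_X_nth)
  qed
  finally show "(fib_step_fps m * (1 - (\<Sum>j = 1..m. fps_X ^ j))) $ n = fps_X $ n" .
qed

text \<open>
  Each generating function is \<open>X\<close> divided by its denominator, so a linear relation between the
  denominators becomes, after multiplication by the three series, a relation between their products.
\<close>

lemma pell_fib_step_fps_identity:
  assumes "m \<ge> 1"
  defines "A \<equiv> fib_step_fps (m - 1)" and "B \<equiv> fib_step_fps m"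
  shows "fps_X * (pell_fps * A * B) = A * (pell_fps - B) - fps_X * (pell_fps * B)"
proof -
  define s :: "int fps" where "s = (\<Sum>j = 1..m - 1. fps_X ^ j)"
  have "(\<Sum>j = 1..m. fps_X ^ j :: int fps) = fps_X + (\<Sum>j = Suc 1..Suc (m - 1). fps_X ^ j)"
    using assms(1) by (simp add: sum.atLeast_Suc_atMost)
  also have "\<dots> = fps_X + fps_X * s"
    by (simp only: sum.shift_bounds_cl_Suc_ivl s_def sum_distrib_left power_Suc)
  finally have geometric: "(\<Sum>j = 1..m. fps_X ^ j) = fps_X + fps_X * s" .
  have P: "pell_fps * (1 - 2 * fps_X - fps_X ^ 2) = fps_X"
    by (rule pell_fps_eq)
  have A: "A * (1 - s) = fps_X"
    unfolding A_def s_def by (rule fib_step_fps_eq)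
  have B: "B * (1 - (fps_X + fps_X * s)) = fps_X"
    unfolding B_def geometric [symmetric] by (rule fib_step_fps_eq)
  have "fps_X * (A * pell_fps - A * B)
      = A * pell_fps * (B * (1 - (fps_X + fps_X * s)))
        - A * B * (pell_fps * (1 - 2 * fps_X - fps_X ^ 2))"
    unfolding P B by (simp add: algebra_simps)
  \<comment> \<open>the relation between the three denominators\<close>
  also have "\<dots> = fps_X * pell_fps * B * (A * (1 - s)) + fps_X ^ 2 * (pell_fps * A * B)"
    by (simp add: algebra_simps power2_eq_square)
  also have "\<dots> = fps_X * (fps_X * (pell_fps * B) + fps_X * (pell_fps * A * B))"
    unfolding A by (simp add: algebra_simps power2_eq_square)
  finally have "A * pell_fps - A * B = fps_X * (pell_fps * B) + fps_X * (pell_fps * A * B)"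
    by simp
  then show ?thesis
    by (simp add: right_diff_distrib)
qed

text \<open>
  The tuples in \<^term>\<open>K 3 b\<close> are exactly the ways to distribute the exponent \<open>b\<close> over the three
  factors, so this turns the sum in the theorem into a coefficient.
\<close>

lemma fps_mult3_nth:
  fixes f g h :: "'a :: comm_ring_1 fps"
  shows "(f * g * h) $ b = (\<Sum>ks\<in>K 3 b. f $ (ks ! 0) * g $ (ks ! 1) * h $ (ks ! 2))"
proof -
  have "(\<Prod>i = 0..2. [f, g, h] ! i) $ b
      = (\<Sum>ks\<in>natpermute b 3. \<Prod>i = 0..2. ([f, g, h] ! i) $ (ks ! i))"
    using fps_prod_nth [of "\<lambda>i. [f, g, h] ! i" 2 b] by simp
  moreover have "K 3 b = natpermute b 3"
    by (auto simp: K_def natpermute_def)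
  moreover have "{0..2 :: nat} = {0, 1, 2}"
    by auto
  ultimately show ?thesis
    by (simp add: mult.assoc)
qed

theorem theorem3p1:
  fixes n m :: nat
  assumes "n \<ge> 1" and "m \<ge> 2"
  shows "(\<Sum>ks\<in>K 3 (n - 1).
            pell (ks ! 0) * fib_step (m - 1) (int (ks ! 1)) * fib_step m (int (ks ! 2)))
       = (\<Sum>j = 0..n. fib_step (m - 1) (int j) * (pell (n - j) - fib_step m (int (n - j))))
         - (\<Sum>j = 0..n - 1. pell j * fib_step m (int (n - 1 - j)))"
proof -
  let ?P = pell_fps and ?A = "fib_step_fps (m - 1)" and ?B = "fib_step_fps m"
  have "(fps_X * (?P * ?A * ?B)) $ n = (?A * (?P - ?B) - fps_X * (?P * ?B)) $ n"
    using assms by (subst pell_fib_step_fps_identity) simp_all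
  then have "(?P * ?A * ?B) $ (n - 1) = (?A * (?P - ?B)) $ n - (?P * ?B) $ (n - 1)"
    using assms by simp
  then show ?thesis
    unfolding fps_mult3_nth by (simp add: fps_mult_nth)
qed

end
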